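(* Let $A,N_1,\dots,N_m\in\mathbb{R}^{n\times n}$, $B\in\mathbb{R}^{n\times m}$, and let $k>0$, $T>0$ be constants such that $$\sigma\Big(I_n\otimes (A+\tfrac{k^2}{2} I_n)+(A+\tfrac{k^2}{2} I_n)\otimes I_n+\sum_{i=1}^m N_i\otimes N_i\Big)\subset \mathbb{C}_-.$$ Let $P\in\mathbb{R}^{n\times n}$ be a symmetric positive definite matrix satisfying $$(A+\tfrac{k^2}{2} I_n)^T P^{-1}+P^{-1}(A+\tfrac{k^2}{2}I_n)+\sum_{i=1}^m N_i^T P^{-1} N_i \leq -P^{-1}BB^T P^{-1}.$$ Let $(p_j)_{j=1,\dots,n}$ be an orthonormal basis of $\mathbb{R}^n$ consisting of eigenvectors of $P$, with corresponding eigenvalues $(\lambda_j)_{j=1,\dots,n}$. Let $u=(u_1,\dots,u_m)^T$ be a control with $\|u(t)\|_2\le k$ for $t\in[0,T]$, and let $x(t,0,u)$ denote the solution of $$\frac{dx(t)}{dt}=Ax(t)+Bu(t)+\sum_{i=1}^m N_i x(t)u_i(t),\quad x(0)=0.$$ Then for every $j\in\{1,\dots,n\}$, $$\lambda_{j}^{-\frac12}\sup_{t\in[0,T]}\big|\langle x(t,0,u),p_j\rangle_2\big|\leq \|u\|_{L^2_T}.$$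
   Context: $\|\cdot\|_2$ and $\langle\cdot,\cdot\rangle_2$ are the Euclidean norm and inner product, and $\|u\|_{L^2_T}^2:=\int_0^T\|u(t)\|_2^2\,dt$. Controls $u$ are (measurable) $L^2_T$ functions. For symmetric matrices, $M_1\le M_2$ means that $M_2-M_1$ is positive semidefinite. $\sigma(\cdot)$ denotes the spectrum, $\mathbb{C}_-$ the open left half-plane, $\otimes$ the Kronecker product. The matrix $P$ is called a type II reachability Gramian. *)

theory Defs
  imports "HOL-Analysis.Analysis"
begin

definition kronecker :: "'a::times^'n^'m \<Rightarrow> 'a^'q^'p \<Rightarrow> 'a^('n \<times> 'q)^('m \<times> 'p)"
    (infixl "\<otimes>\<^sub>K" 75) where
  "A \<otimes>\<^sub>K B = (\<chi> r c. A $ fst r $ fst c * B $ snd r $ snd c)"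

definition spectrum :: "complex^'n^'n \<Rightarrow> complex set" where
  "spectrum M = {z. \<exists>v. v \<noteq> 0 \<and> M *v v = z *s v}"

definition pos_semidef :: "real^'n^'n \<Rightarrow> bool" where
  "pos_semidef M \<longleftrightarrow> transpose M = M \<and> (\<forall>v. 0 \<le> v \<bullet> (M *v v))"

definition pos_def :: "real^'n^'n \<Rightarrow> bool" where
  "pos_def M \<longleftrightarrow> transpose M = M \<and> (\<forall>v. v \<noteq> 0 \<longrightarrow> 0 < v \<bullet> (M *v v))"

definition loewner_le :: "real^'n^'n \<Rightarrow> real^'n^'n \<Rightarrow> bool" (infix "\<le>\<^sub>L" 50) where
  "M1 \<le>\<^sub>L M2 \<longleftrightarrow> pos_semidef (M2 - M1)"

definition orthonormal_basis :: "('n \<Rightarrow> real^'n) \<Rightarrow> bool" where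
  "orthonormal_basis p \<longleftrightarrow>
     (\<forall>i j. p i \<bullet> p j = (if i = j then 1 else 0)) \<and> span (range p) = UNIV"

definition L2_control :: "real \<Rightarrow> (real \<Rightarrow> real^'m) \<Rightarrow> bool" where
  "L2_control T u \<longleftrightarrow>
     u \<in> borel_measurable (lebesgue_on {0..T}) \<and>
     integrable (lebesgue_on {0..T}) (\<lambda>t. (norm (u t))\<^sup>2)"

definition L2_control_norm :: "real \<Rightarrow> (real \<Rightarrow> real^'m) \<Rightarrow> real" where
  "L2_control_norm T u = sqrt (\<integral>t. (norm (u t))\<^sup>2 \<partial>lebesgue_on {0..T})"

text \<open>Absolute continuity of a function. The members of a division are nonempty, pairwise
  non-overlapping compact intervals, finitely many of them, with end points \<open>Inf K\<close> and \<open>Sup K\<close>;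
  their union \<open>S\<close> need not be an interval. (The library's \<open>absolutely_continuous\<close> concerns
  measures.)\<close>

definition abs_continuous_on :: "real set \<Rightarrow> (real \<Rightarrow> 'a::real_normed_vector) \<Rightarrow> bool" where
  "abs_continuous_on I f \<longleftrightarrow>
     (\<forall>\<epsilon>>0. \<exists>\<delta>>0. \<forall>D S. D division_of S \<and> S \<subseteq> I \<and> (\<Sum>K\<in>D. Sup K - Inf K) < \<delta>
        \<longrightarrow> (\<Sum>K\<in>D. norm (f (Sup K) - f (Inf K))) < \<epsilon>)"

text \<open>As the control is only measurable, solutions are understood in the sense of Caratheodory:
  absolutely continuous functions that satisfy the differential equation almost everywhere.\<close>

definition bilinear_solution ::
  "real^'n^'n \<Rightarrow> real^'m^'n \<Rightarrow> ('m \<Rightarrow> real^'n^'n) \<Rightarrow> real \<Rightarrow> real^'n \<Rightarrow>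
   (real \<Rightarrow> real^'m) \<Rightarrow> (real \<Rightarrow> real^'n) \<Rightarrow> bool" where
  "bilinear_solution A B N T x0 u x \<longleftrightarrow>
     x 0 = x0 \<and> abs_continuous_on {0..T} x \<and>
     (AE t in lebesgue_on {0..T}.
        (x has_vector_derivative
           A *v x t + B *v u t + (\<Sum>i\<in>UNIV. (u t $ i) *\<^sub>R (N i *v x t)))
        (at t within {0..T}))"

end

(* With Q = P^(-1), the function V(t) = x(t) . Q x(t) satisfies V' <= |u|^2 almost everywhere: the
   matrix inequality bounds 2 Ax . Qx by -k^2 V - sum_i N_i x . Q N_i x - |B^T Q x|^2, and Young's
   inequality lets these terms absorb the contributions of N_i x u_i (using |u| <= k) and of B u.
   Hence V(t) <= |u|_{L^2}^2, and <x, p_j>^2 <= lambda_j V by Cauchy-Schwarz for the form of P. *)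
theory Submission
  imports Defs
begin

lemma abs_continuous_on_subset:
  assumes "abs_continuous_on I f" "J \<subseteq> I"
  shows "abs_continuous_on J f"
  using assms unfolding abs_continuous_on_def by (meson subset_trans)

lemma abs_continuous_onD:
  assumes "abs_continuous_on I f" "e > 0"
  shows "\<exists>d>0. \<forall>D S. D division_of S \<longrightarrow> S \<subseteq> I \<longrightarrow> (\<Sum>K\<in>D. Sup K - Inf K) < d
           \<longrightarrow> (\<Sum>K\<in>D. norm (f (Sup K) - f (Inf K))) < e"
  by (rule mp[OF spec[OF assms(1)[unfolded abs_continuous_on_def imp_conjL]] assms(2)])

lemma division_of_Inf_Sup_real:
  fixes K S :: "real set"
  assumes "D division_of S" "K \<in> D"
  shows "Inf K \<le> Sup K" "K = {Inf K..Sup K}" "Inf K \<in> S" "Sup K \<in> S"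
proof -
  obtain c d where K: "K = cbox c d" "K \<noteq> {}" "K \<subseteq> S"
    using division_ofD(2,3,4)[OF assms(1,2)] by metis
  then have "c \<le> d" by simp
  with K show "Inf K \<le> Sup K" "K = {Inf K..Sup K}" "Inf K \<in> S" "Sup K \<in> S"
    by auto
qed

lemma abs_continuous_on_Lipschitz_comp:
  assumes f: "abs_continuous_on I f" and "C > 0"
    and le: "\<And>s t. s \<in> I \<Longrightarrow> t \<in> I \<Longrightarrow> norm (g t - g s) \<le> C * norm (f t - f s)"
  shows "abs_continuous_on I g"
  unfolding abs_continuous_on_def
proof (intro allI impI)
  fix e :: real assume "e > 0"
  then have "e / C > 0" using \<open>C > 0\<close> by simp
  obtain d where d: "d > 0" and
    *: "\<forall>D S. D division_of S \<longrightarrow> S \<subseteq> I \<longrightarrow> (\<Sum>K\<in>D. Sup K - Inf K) < d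
        \<longrightarrow> (\<Sum>K\<in>D. norm (f (Sup K) - f (Inf K))) < e / C"
    using abs_continuous_onD[OF f \<open>e / C > 0\<close>] by (elim exE conjE)
  show "\<exists>\<delta>>0. \<forall>D S. D division_of S \<and> S \<subseteq> I \<and> (\<Sum>K\<in>D. Sup K - Inf K) < \<delta>
        \<longrightarrow> (\<Sum>K\<in>D. norm (g (Sup K) - g (Inf K))) < e"
  proof (intro exI[of _ d] conjI allI impI d)
    fix D S assume D: "D division_of S \<and> S \<subseteq> I \<and> (\<Sum>K\<in>D. Sup K - Inf K) < d"
    have "(\<Sum>K\<in>D. norm (g (Sup K) - g (Inf K))) \<le> (\<Sum>K\<in>D. C * norm (f (Sup K) - f (Inf K)))"
      using D division_of_Inf_Sup_real(3,4) by (intro sum_mono le) (meson subsetD)+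
    also have "\<dots> = C * (\<Sum>K\<in>D. norm (f (Sup K) - f (Inf K)))"
      by (simp add: sum_distrib_left)
    also have "\<dots> < C * (e / C)"
      using *[rule_format, of D S] D \<open>C > 0\<close> by (intro mult_strict_left_mono) auto
    finally show "(\<Sum>K\<in>D. norm (g (Sup K) - g (Inf K))) < e"
      using \<open>C > 0\<close> by simp
  qed
qed

lemma abs_continuous_on_imp_continuous_on:
  assumes f: "abs_continuous_on {a..b} f"
  shows "continuous_on {a..b} f"
  unfolding continuous_on_iff
proof (intro ballI allI impI)
  fix s e :: real assume s: "s \<in> {a..b}" and "e > 0"
  obtain d where d: "d > 0" and
    *: "\<forall>D S. D division_of S \<longrightarrow> S \<subseteq> {a..b} \<longrightarrow> (\<Sum>K\<in>D. Sup K - Inf K) < d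
        \<longrightarrow> (\<Sum>K\<in>D. norm (f (Sup K) - f (Inf K))) < e"
    using abs_continuous_onD[OF f \<open>e > 0\<close>] by (elim exE conjE)
  have **: "dist (f v) (f u) < e" if "u \<le> v" "u \<in> {a..b}" "v \<in> {a..b}" "v - u < d" for u v
  proof -
    have "{cbox u v} division_of cbox u v"
      using that by (intro division_of_self) auto
    from *[rule_format, OF this] that show ?thesis by (simp add: dist_norm)
  qed
  show "\<exists>d>0. \<forall>t\<in>{a..b}. dist t s < d \<longrightarrow> dist (f t) (f s) < e"
  proof (intro exI[of _ d] conjI ballI impI d)
    fix t assume "t \<in> {a..b}" "dist t s < d"
    then show "dist (f t) (f s) < e"
      using **[of s t] **[of t s] s by (cases "s \<le> t") (auto simp: dist_real_def dist_commute)
  qed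
qed

lemma negligible_outer_open:
  fixes E :: "'a::euclidean_space set"
  assumes "negligible E" "e > 0"
  obtains U where "open U" "E \<subseteq> U" "U \<in> lmeasurable" "measure lebesgue U < e"
proof -
  have E: "E \<in> null_sets lebesgue" using assms negligible_iff_null_sets by blast
  then have "E \<in> sets lebesgue" by blast
  then obtain U where U: "open U" "E \<subseteq> U" "U - E \<in> lmeasurable" "emeasure lebesgue (U - E) < ennreal e"
    using \<open>e > 0\<close> by (rule sets_lebesgue_outer_open)
  have "U = (U - E) \<union> E" using U by blast
  then have eq: "emeasure lebesgue U = emeasure lebesgue (U - E)"
    using emeasure_Un_null_set[of "U - E" lebesgue E] U(3) E by (metis fmeasurableD)
  have "U \<in> sets lebesgue" using U(1) by (simp add: borel_open)
  moreover have "emeasure lebesgue U < \<infinity>" using eq U(4) by (metis ennreal_less_top infinity_ennreal_def order.strict_trans)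
  ultimately have "U \<in> lmeasurable" by (intro fmeasurableI)
  moreover have "measure lebesgue U < e"
    using eq U(4) \<open>e > 0\<close> \<open>U \<in> lmeasurable\<close> by (metis emeasure_eq_measure2 ennreal_less_iff measure_nonneg)
  ultimately show thesis using that U by blast
qed

lemma has_real_derivative_increment_gauge:
  fixes g :: "real \<Rightarrow> real"
  assumes der: "(g has_real_derivative D) (at t within S)" and "e > 0"
  obtains r where "r > 0"
    "\<And>u v. \<lbrakk>u \<le> t; t \<le> v; u \<in> S; v \<in> S; {u..v} \<subseteq> ball t r\<rbrakk>
       \<Longrightarrow> g v - g u \<le> (D + e) * (v - u)"
proof -
  obtain r where r: "r > 0" and
    *: "\<And>s. s \<in> S \<Longrightarrow> \<bar>s - t\<bar> < r \<Longrightarrow> \<bar>g s - g t - D * (s - t)\<bar> \<le> e * \<bar>s - t\<bar>"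
    using der \<open>e > 0\<close> unfolding has_field_derivative_def has_derivative_within_alt by force
  have "g v - g u \<le> (D + e) * (v - u)"
    if "u \<le> t" "t \<le> v" "u \<in> S" "v \<in> S" and uv: "{u..v} \<subseteq> ball t r" for u v
  proof -
    have "u \<in> {u..v}" "v \<in> {u..v}" using that by auto
    then have "u \<in> ball t r" "v \<in> ball t r" using uv by blast+
    then have "\<bar>u - t\<bar> < r" "\<bar>v - t\<bar> < r" by (auto simp: dist_real_def)
    from *[OF \<open>u \<in> S\<close> this(1)] *[OF \<open>v \<in> S\<close> this(2)]
    have "g t - g u \<le> D * (t - u) + e * (t - u)" "g v - g t \<le> D * (v - t) + e * (v - t)"
      using that by (auto simp: abs_le_iff algebra_simps)
    then show ?thesis by (simp add: algebra_simps)
  qed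
  with r that show thesis by blast
qed

text \<open>Take a Henstock gauge for \<open>h\<close> (set to \<open>0\<close> on \<open>E\<close>) that is subordinate to the derivative off \<open>E\<close> and
  to a small open superset of \<open>E\<close> on \<open>E\<close>. The intervals tagged in \<open>E\<close> then contribute little by absolute
  continuity. This avoids Lebesgue's differentiation theorem.\<close>

lemma abs_continuous_on_diff_le_integral:
  fixes g h :: "real \<Rightarrow> real"
  assumes "a \<le> b" and ac: "abs_continuous_on {a..b} g" and E: "negligible E"
    and der: "\<And>t. t \<in> {a..b} - E \<Longrightarrow> \<exists>D\<le>h t. (g has_real_derivative D) (at t within {a..b})"
    and h: "(h has_integral I) {a..b}"
  shows "g b - g a \<le> I"
proof (rule field_le_epsilon)
  fix e0 :: real assume "e0 > 0"
  define e where "e = e0 / (b - a + 2)"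
  have "b - a + 2 > 0" using \<open>a \<le> b\<close> by simp
  then have "e > 0" and "e * (b - a + 2) = e0"
    using \<open>e0 > 0\<close> by (simp_all add: e_def)
  then have e0: "e * (b - a) + 2 * e = e0" by (simp add: algebra_simps)
  define h' where "h' t = (if t \<in> E then 0 else h t)" for t
  have "(h' has_integral I) (cbox a b)"
    using has_integral_spike[OF E _ h, of h'] by (simp add: h'_def)
  then obtain \<gamma> where \<gamma>: "gauge \<gamma>" and
    sum\<gamma>: "\<And>p. p tagged_division_of cbox a b \<Longrightarrow> \<gamma> fine p \<Longrightarrow>
       norm ((\<Sum>(t,K)\<in>p. measure lborel K *\<^sub>R h' t) - I) < e"
    unfolding has_integral using \<open>e > 0\<close> by meson
  obtain d where "d > 0" and
    d: "\<forall>D S. D division_of S \<longrightarrow> S \<subseteq> {a..b} \<longrightarrow> (\<Sum>K\<in>D. Sup K - Inf K) < d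
        \<longrightarrow> (\<Sum>K\<in>D. norm (g (Sup K) - g (Inf K))) < e"
    using abs_continuous_onD[OF ac \<open>e > 0\<close>] by (elim exE conjE)
  obtain U where U: "open U" "E \<subseteq> U" "U \<in> lmeasurable" "measure lebesgue U < d"
    using negligible_outer_open[OF E \<open>d > 0\<close>] .
  have "\<exists>r>0. t \<in> {a..b} - E \<longrightarrow> (\<forall>u v. u \<le> t \<and> t \<le> v \<and> u \<in> {a..b} \<and> v \<in> {a..b} \<and> {u..v} \<subseteq> ball t r
       \<longrightarrow> g v - g u \<le> (h t + e) * (v - u))" for t
  proof (cases "t \<in> {a..b} - E")
    case True
    then obtain D where D: "D \<le> h t" "(g has_real_derivative D) (at t within {a..b})"
      using der by blast
    obtain r where r: "r > 0" "\<And>u v. \<lbrakk>u \<le> t; t \<le> v; u \<in> {a..b}; v \<in> {a..b}; {u..v} \<subseteq> ball t r\<rbrakk>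
       \<Longrightarrow> g v - g u \<le> (D + e) * (v - u)"
      using has_real_derivative_increment_gauge[OF D(2) \<open>e > 0\<close>] by blast
    have "(D + e) * (v - u) \<le> (h t + e) * (v - u)" if "u \<le> t" "t \<le> v" for u v
      using D that by (intro mult_right_mono) auto
    with r show ?thesis by (meson order_trans)
  qed (auto intro: exI[of _ 1])
  then obtain r where r0: "\<And>t. r t > 0" and
    r: "\<And>t u v. \<lbrakk>t \<in> {a..b} - E; u \<le> t; t \<le> v; u \<in> {a..b}; v \<in> {a..b}; {u..v} \<subseteq> ball t (r t)\<rbrakk>
       \<Longrightarrow> g v - g u \<le> (h t + e) * (v - u)"
    by metis
  define \<gamma>' where "\<gamma>' t = (if t \<in> E then U else ball t (r t))" for t
  have "gauge \<gamma>'"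
    using U r0 by (auto simp: gauge_def \<gamma>'_def)
  then obtain p where p: "p tagged_division_of cbox a b" "(\<lambda>t. \<gamma> t \<inter> \<gamma>' t) fine p"
    using fine_division_exists[OF gauge_Int[OF \<gamma>]] by blast
  then have fine: "\<gamma> fine p" "\<gamma>' fine p" by (auto simp: fine_Int)
  have p_interval: "\<exists>u v. K = {u..v} \<and> u \<le> t \<and> t \<le> v \<and> u \<in> {a..b} \<and> v \<in> {a..b}"
    if "(t, K) \<in> p" for t K
  proof -
    have "t \<in> K" "K \<subseteq> {a..b}" "\<exists>u v. K = {u..v}"
      using tagged_division_ofD(2-4)[OF p(1) that] by auto
    then show ?thesis by auto
  qed
  define q where "q = {(t,K)\<in>p. t \<in> E}"
  have "q \<subseteq> p" by (auto simp: q_def)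
  have "finite p" using tagged_division_ofD(1)[OF p(1)] .
  have q: "q tagged_partial_division_of cbox a b"
    by (rule tagged_partial_division_subset[OF _ \<open>q \<subseteq> p\<close>])
      (use p(1) in \<open>simp add: tagged_division_of_def\<close>)
  define D where "D = snd ` q"
  have D: "D division_of \<Union>D"
    unfolding D_def using partial_division_of_tagged_division[OF q] .
  have D_sub: "\<Union>D \<subseteq> {a..b}" "\<Union>D \<subseteq> U"
  proof -
    show "\<Union>D \<subseteq> {a..b}"
      using tagged_partial_division_ofD(3)[OF q] by (fastforce simp: D_def)
    show "\<Union>D \<subseteq> U"
      using fine(2) unfolding fine_def by (fastforce simp: D_def q_def \<gamma>'_def)
  qed
  have "(\<Sum>K\<in>D. Sup K - Inf K) = (\<Sum>K\<in>D. measure lebesgue K)"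
  proof (rule sum.cong[OF refl])
    fix K assume "K \<in> D"
    from division_of_Inf_Sup_real(1,2)[OF D this]
    show "Sup K - Inf K = measure lebesgue K"
      by (metis content_real measure_completion atLeastAtMost_borel sets_lborel)
  qed
  also have "\<dots> = measure lebesgue (\<Union>D)"
    using content_division[OF D] .
  also have "\<dots> \<le> measure lebesgue U"
    using D_sub U lmeasurable_division[OF D] by (intro measure_mono_fmeasurable) auto
  finally have "(\<Sum>K\<in>D. norm (g (Sup K) - g (Inf K))) < e"
    using U by (intro d[rule_format, OF D D_sub(1)]) auto
  moreover have "(\<Sum>(t,K)\<in>q. norm (g (Sup K) - g (Inf K))) = (\<Sum>K\<in>D. norm (g (Sup K) - g (Inf K)))"
  proof -
    \<comment> \<open>\<open>Sup {}\<close> and \<open>Inf {}\<close> are junk, but the library lemma ranges over empty boxes as well\<close>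
    define f where "f K = (if K = {} then 0 else norm (g (Sup K) - g (Inf K)))" for K
    have "(\<Sum>(t,K)\<in>q. f K) = (\<Sum>K\<in>D. f K)"
      unfolding D_def
    proof (rule sum.over_tagged_division_lemma[OF tagged_partial_division_of_Union_self[OF q]])
      fix u v :: real assume "box u v = {}"
      then show "f (cbox u v) = 0"
        by (cases "u = v") (auto simp: f_def)
    qed
    moreover have "(\<Sum>(t,K)\<in>q. f K) = (\<Sum>(t,K)\<in>q. norm (g (Sup K) - g (Inf K)))"
      using tagged_partial_division_ofD(2)[OF q] by (intro sum.cong) (fastforce simp: f_def)+
    moreover have "(\<Sum>K\<in>D. f K) = (\<Sum>K\<in>D. norm (g (Sup K) - g (Inf K)))"
      using division_ofD(3)[OF D] by (intro sum.cong) (auto simp: f_def)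
    ultimately show ?thesis by simp
  qed
  ultimately have sum_q: "(\<Sum>(t,K)\<in>q. g (Sup K) - g (Inf K)) < e"
    by (smt (verit, best) case_prod_unfold norm_ge_zero real_norm_def sum_mono)
  have "(\<Sum>(t,K)\<in>p-q. g (Sup K) - g (Inf K)) \<le> (\<Sum>(t,K)\<in>p-q. (h' t + e) * measure lborel K)"
  proof (rule sum_mono, clarify)
    fix t K assume tK: "(t, K) \<in> p" "(t, K) \<notin> q"
    then have "t \<notin> E" by (auto simp: q_def)
    obtain u v where uv: "K = {u..v}" "u \<le> t" "t \<le> v" "u \<in> {a..b}" "v \<in> {a..b}"
      using p_interval[OF tK(1)] by blast
    have "K \<subseteq> ball t (r t)"
      using fine(2) tK(1) \<open>t \<notin> E\<close> unfolding fine_def by (force simp: \<gamma>'_def)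
    then have "g v - g u \<le> (h t + e) * (v - u)"
      using uv \<open>t \<notin> E\<close> by (intro r) auto
    then show "g (Sup K) - g (Inf K) \<le> (h' t + e) * measure lborel K"
      using uv \<open>t \<notin> E\<close> by (simp add: h'_def)
  qed
  also have "\<dots> \<le> (\<Sum>(t,K)\<in>p. (h' t + e) * measure lborel K)"
  proof (rule sum_mono2[OF \<open>finite p\<close>])
    fix z assume "z \<in> p - (p - q)"
    then have "fst z \<in> E" by (auto simp: q_def)
    then show "0 \<le> (case z of (t,K) \<Rightarrow> (h' t + e) * measure lborel K)"
      using \<open>e > 0\<close> by (auto simp: h'_def split: prod.split)
  qed auto
  also have "\<dots> = (\<Sum>(t,K)\<in>p. measure lborel K *\<^sub>R h' t) + e * (\<Sum>(t,K)\<in>p. measure lborel K)"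
    by (simp add: sum_distrib_left sum.distrib[symmetric] case_prod_unfold algebra_simps)
  also have "(\<Sum>(t,K)\<in>p. measure lborel K) = b - a"
    using additive_content_tagged_division[OF p(1)] \<open>a \<le> b\<close> by simp
  finally have "(\<Sum>(t,K)\<in>p-q. g (Sup K) - g (Inf K)) \<le> I + e + e * (b - a)"
    using sum\<gamma>[OF p(1) fine(1)] by (auto simp: abs_less_iff)
  moreover have "g b - g a = (\<Sum>(t,K)\<in>p-q. g (Sup K) - g (Inf K)) + (\<Sum>(t,K)\<in>q. g (Sup K) - g (Inf K))"
    unfolding sum.subset_diff[OF \<open>q \<subseteq> p\<close> \<open>finite p\<close>, symmetric]
    using additive_tagged_division_1[OF \<open>a \<le> b\<close>, of p g] p(1) by simp
  ultimately show "g b - g a \<le> I + e0"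
    using sum_q e0 by linarith
qed

lemma mat_matrix_vector_mult:
  fixes x :: "'a::comm_semiring_1^'n"
  shows "mat c *v x = c *s x"
  by (simp add: vec_eq_iff matrix_vector_mult_def mat_def if_distrib[of "\<lambda>y. y * _"] cong: if_cong)

lemma inner_matrix_vector_mult_transpose:
  fixes M :: "real^'n^'m"
  shows "x \<bullet> (M *v y) = (transpose M *v x) \<bullet> y"
  by (simp add: dot_lmul_matrix)

lemma pos_def_matrix_inv:
  assumes "pos_def P"
  shows "P ** matrix_inv P = mat 1" "matrix_inv P ** P = mat 1" "pos_def (matrix_inv P)"
proof -
  have sym: "transpose P = P" and pos: "\<And>v. v \<noteq> 0 \<Longrightarrow> 0 < v \<bullet> (P *v v)"
    using assms by (auto simp: pos_def_def)
  have "x = 0" if "P *v x = 0" for x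
    using pos[of x] that by force
  then have "inj ((*v) P)"
    by (simp add: linear_injective_0[OF matrix_vector_mul_linear])
  then have "\<exists>R. R ** P = mat 1" using matrix_left_invertible_injective by blast
  then have "invertible P" using matrix_left_right_inverse unfolding invertible_def by blast
  then have "P ** matrix_inv P = mat 1 \<and> matrix_inv P ** P = mat 1"
    unfolding invertible_def matrix_inv_def by (rule someI_ex)
  then show inv: "P ** matrix_inv P = mat 1" "matrix_inv P ** P = mat 1" by auto
  have "transpose (matrix_inv P) ** P = mat 1"
    by (metis inv(1) matrix_transpose_mul sym transpose_mat)
  then have sym': "transpose (matrix_inv P) = matrix_inv P"
    by (metis inv(1) matrix_mul_assoc matrix_mul_lid matrix_mul_rid)
  have "0 < v \<bullet> (matrix_inv P *v v)" if "v \<noteq> 0" for v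
  proof -
    have v: "v = P *v (matrix_inv P *v v)"
      by (simp add: inv(1) matrix_vector_mul_assoc)
    then have "matrix_inv P *v v \<noteq> 0" using that by force
    then have "0 < (matrix_inv P *v v) \<bullet> (P *v (matrix_inv P *v v))" by (rule pos)
    then show ?thesis using v by (simp add: inner_commute)
  qed
  with sym' show "pos_def (matrix_inv P)" by (simp add: pos_def_def)
qed

lemma sum_matrix_vector_mult:
  fixes x :: "real^'n"
  shows "(\<Sum>i\<in>I. M i) *v x = (\<Sum>i\<in>I. M i *v x)"
  by (induction I rule: infinite_finite_induct) (simp_all add: matrix_vector_mult_add_rdistrib)

lemma Gramian_dissipation:
  fixes A Q :: "real^'n^'n" and B :: "real^'m^'n" and N :: "'m::finite \<Rightarrow> real^'n^'n"
  assumes Q: "pos_semidef Q" and w: "norm w \<le> k"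
    and lmi: "transpose (A + mat (k\<^sup>2 / 2)) ** Q + Q ** (A + mat (k\<^sup>2 / 2))
           + (\<Sum>i\<in>UNIV. transpose (N i) ** Q ** N i) \<le>\<^sub>L - (Q ** B ** transpose B ** Q)"
  shows "2 * ((A *v y + B *v w + (\<Sum>i\<in>UNIV. (w $ i) *\<^sub>R (N i *v y))) \<bullet> (Q *v y)) \<le> (norm w)\<^sup>2"
proof -
  have sym: "transpose Q = Q" and pos: "\<And>v. 0 \<le> v \<bullet> (Q *v v)"
    using Q by (auto simp: pos_semidef_def)
  have symQ: "v \<bullet> (Q *v z) = z \<bullet> (Q *v v)" for v z
    by (metis inner_commute inner_matrix_vector_mult_transpose sym)
  define V where "V = y \<bullet> (Q *v y)"
  define b where "b = transpose B *v (Q *v y)"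
  define n where "n i = (N i *v y) \<bullet> (Q *v (N i *v y))" for i
  have "0 \<le> y \<bullet> ((- (Q ** B ** transpose B ** Q) - (transpose (A + mat (k\<^sup>2 / 2)) ** Q + Q ** (A + mat (k\<^sup>2 / 2))
           + (\<Sum>i\<in>UNIV. transpose (N i) ** Q ** N i))) *v y)"
    using lmi by (simp add: loewner_le_def pos_semidef_def)
  also have "\<dots> = - (b \<bullet> b) - (2 * ((A *v y) \<bullet> (Q *v y)) + k\<^sup>2 * V + (\<Sum>i\<in>UNIV. n i))"
  proof -
    have "y \<bullet> ((Q ** B ** transpose B ** Q) *v y) = b \<bullet> b"
      using inner_matrix_vector_mult_transpose[of y Q] inner_matrix_vector_mult_transpose[of _ B]
      by (simp add: matrix_vector_mul_assoc[symmetric] sym b_def)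
    moreover have "y \<bullet> ((transpose (A + mat (k\<^sup>2 / 2)) ** Q) *v y) = (A *v y) \<bullet> (Q *v y) + k\<^sup>2 / 2 * V"
      using inner_matrix_vector_mult_transpose[of y "transpose (A + mat (k\<^sup>2 / 2))"]
      by (simp add: matrix_vector_mul_assoc[symmetric] matrix_vector_mult_add_rdistrib
          mat_matrix_vector_mult scalar_mult_eq_scaleR inner_add_left V_def)
    moreover have "y \<bullet> ((Q ** (A + mat (k\<^sup>2 / 2))) *v y) = (A *v y) \<bullet> (Q *v y) + k\<^sup>2 / 2 * V"
      using symQ[of y "(A + mat (k\<^sup>2 / 2)) *v y"]
      by (simp add: matrix_vector_mul_assoc[symmetric] matrix_vector_mult_add_rdistrib
          mat_matrix_vector_mult scalar_mult_eq_scaleR inner_add_left V_def)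
    moreover have "y \<bullet> ((transpose (N i) ** Q ** N i) *v y) = n i" for i
      using inner_matrix_vector_mult_transpose[of y "transpose (N i)"]
      by (simp add: matrix_vector_mul_assoc[symmetric] n_def)
    ultimately show ?thesis
      by (simp add: matrix_vector_mult_diff_rdistrib matrix_vector_mult_add_rdistrib
          sum_matrix_vector_mult inner_diff_right inner_add_right inner_sum_right
          matrix_vector_mult_diff_rdistrib[of 0, simplified])
  qed
  finally have A: "2 * ((A *v y) \<bullet> (Q *v y)) \<le> - (b \<bullet> b) - k\<^sup>2 * V - (\<Sum>i\<in>UNIV. n i)" by linarith
  have "(B *v w) \<bullet> (Q *v y) = w \<bullet> b"
    unfolding b_def by (metis inner_commute inner_matrix_vector_mult_transpose)
  moreover have "0 \<le> (w - b) \<bullet> (w - b)" by simp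
  ultimately have B: "2 * ((B *v w) \<bullet> (Q *v y)) \<le> w \<bullet> w + b \<bullet> b"
    by (simp add: inner_diff_left inner_diff_right inner_commute)
  have N: "2 * (w $ i * ((N i *v y) \<bullet> (Q *v y))) \<le> (w $ i)\<^sup>2 * V + n i" for i
  proof -
    have "0 \<le> (N i *v y - (w $ i) *\<^sub>R y) \<bullet> (Q *v (N i *v y - (w $ i) *\<^sub>R y))" by (rule pos)
    then show ?thesis
      using symQ[of y "N i *v y"]
      by (simp add: matrix_vector_mult_diff_distrib matrix_vector_mult_scaleR inner_diff_left
          inner_diff_right V_def n_def power2_eq_square algebra_simps)
  qed
  have "2 * ((\<Sum>i\<in>UNIV. (w $ i) *\<^sub>R (N i *v y)) \<bullet> (Q *v y)) \<le> (\<Sum>i\<in>UNIV. (w $ i)\<^sup>2 * V + n i)"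
    using N by (auto simp: inner_sum_left sum_distrib_left intro: sum_mono)
  also have "\<dots> = (norm w)\<^sup>2 * V + (\<Sum>i\<in>UNIV. n i)"
    by (simp add: sum.distrib sum_distrib_right[symmetric] power2_norm_eq_inner inner_vec_def
        power2_eq_square[of "w $ _"])
  also have "(norm w)\<^sup>2 * V \<le> k\<^sup>2 * V"
    using w pos by (intro mult_right_mono power_mono) (auto simp: V_def)
  finally show ?thesis
    using A B by (simp add: inner_add_left power2_norm_eq_inner)
qed

lemma abs_continuous_on_quadratic_form:
  fixes M :: "real^'n^'n"
  assumes x: "abs_continuous_on {a..b} x"
  shows "abs_continuous_on {a..b} (\<lambda>t. x t \<bullet> (M *v x t))"
proof -
  have "compact (x ` {a..b})"
    using abs_continuous_on_imp_continuous_on[OF x] compact_continuous_image by blast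
  then obtain R where R: "R > 0" "\<And>t. t \<in> {a..b} \<Longrightarrow> norm (x t) \<le> R"
    using compact_imp_bounded bounded_pos by (metis image_eqI)
  obtain K where K: "K > 0" "\<And>v. norm (M *v v) \<le> K * norm v"
    using bounded_linear.pos_bounded[OF matrix_vector_mul_bounded_linear[of M]]
    by (metis mult.commute)
  show ?thesis
  proof (rule abs_continuous_on_Lipschitz_comp[OF x])
    show "2 * K * R > 0" using K R by simp
    fix s t assume st: "s \<in> {a..b}" "t \<in> {a..b}"
    have "\<bar>(x t - x s) \<bullet> (M *v x t)\<bar> \<le> norm (x t - x s) * (K * R)"
      using K R(2)[OF st(2)]
      by (intro order_trans[OF Cauchy_Schwarz_ineq2] mult_left_mono order_trans[OF K(2)]) auto
    moreover have "\<bar>x s \<bullet> (M *v (x t - x s))\<bar> \<le> R * (K * norm (x t - x s))"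
      using K R(2)[OF st(1)] R(1)
      by (intro order_trans[OF Cauchy_Schwarz_ineq2] mult_mono K(2)) auto
    moreover have "x t \<bullet> (M *v x t) - x s \<bullet> (M *v x s) =
        (x t - x s) \<bullet> (M *v x t) + x s \<bullet> (M *v (x t - x s))"
      by (simp add: matrix_vector_mult_diff_distrib inner_diff_left inner_diff_right)
    ultimately show "norm (x t \<bullet> (M *v x t) - x s \<bullet> (M *v x s)) \<le> 2 * K * R * norm (x t - x s)"
      by (simp add: abs_le_iff algebra_simps)
  qed
qed

lemma AE_lebesgue_on_negligible:
  assumes "AE t in lebesgue_on S. Q t" "S \<in> sets lebesgue"
  obtains E where "negligible E" "\<And>t. t \<in> S - E \<Longrightarrow> Q t"
proof -
  have "AE t in lebesgue. t \<in> S \<longrightarrow> Q t"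
    using assms by (simp add: AE_restrict_space_iff)
  then obtain E where "E \<in> null_sets lebesgue" "{t. \<not> (t \<in> S \<longrightarrow> Q t)} \<subseteq> E"
    unfolding eventually_ae_filter by auto
  then show thesis
    by (intro that[of E]) (auto simp: negligible_iff_null_sets)
qed

lemma eigenvector_component_bound:
  assumes P: "pos_def P" and "P *v q = l *\<^sub>R q" "norm q = 1"
  shows "l > 0" "(x \<bullet> q)\<^sup>2 \<le> l * (x \<bullet> (matrix_inv P *v x))"
proof -
  define z where "z = matrix_inv P *v x"
  have qq: "q \<bullet> q = 1" using assms(3) by (simp add: norm_eq_1)
  then have "q \<noteq> 0" by auto
  then have "0 < q \<bullet> (P *v q)" using P by (simp add: pos_def_def)
  then show "l > 0" using assms(2) qq by simp
  have sym: "transpose P = P" and pos: "\<And>v. 0 \<le> v \<bullet> (P *v v)"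
    using P by (auto simp: pos_def_def) (metis inner_zero_left less_eq_real_def)
  have xz: "x = P *v z" using pos_def_matrix_inv(1)[OF P] by (simp add: z_def matrix_vector_mul_assoc)
  have q: "q \<bullet> (P *v z) = l * (z \<bullet> q)"
    using inner_matrix_vector_mult_transpose[of q P z] assms(2) sym by (simp add: inner_commute)
  define c where "c = z \<bullet> q"
  have "0 \<le> (z - c *\<^sub>R q) \<bullet> (P *v (z - c *\<^sub>R q))" by (rule pos)
  also have "\<dots> = z \<bullet> (P *v z) - l * c\<^sup>2"
    using q qq by (simp add: matrix_vector_mult_diff_distrib matrix_vector_mult_scaleR inner_diff_left
          inner_diff_right assms(2) c_def power2_eq_square inner_commute algebra_simps)
  finally have "l * c\<^sup>2 \<le> x \<bullet> z" by (simp add: xz inner_commute)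
  moreover have "x \<bullet> q = l * c" using q by (simp add: xz c_def inner_commute)
  ultimately show "(x \<bullet> q)\<^sup>2 \<le> l * (x \<bullet> (matrix_inv P *v x))"
    using \<open>l > 0\<close> mult_left_mono[of "l * c\<^sup>2" "x \<bullet> z" l]
    by (simp add: z_def power2_eq_square algebra_simps)
qed


lemma powr_neg_half_mult_le:
  assumes "l > 0" "c\<^sup>2 \<le> l * s" "0 \<le> s"
  shows "l powr (-1/2) * \<bar>c\<bar> \<le> sqrt s"
proof -
  have "\<bar>c\<bar> \<le> sqrt l * sqrt s"
    using assms by (metis real_sqrt_abs real_sqrt_le_mono real_sqrt_mult)
  moreover have "l powr (-1/2) * sqrt l = 1"
    using assms by (simp add: powr_half_sqrt[symmetric] powr_add[symmetric])
  ultimately show ?thesis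
    using mult_left_mono[of "\<bar>c\<bar>" "sqrt l * sqrt s" "l powr (-1/2)"] by (simp add: mult.assoc[symmetric])
qed

lemma bilinear_solution_quadratic_form_le:
  fixes A Q :: "real^'n^'n" and B :: "real^'m^'n" and N :: "'m::finite \<Rightarrow> real^'n^'n"
  assumes Q: "pos_semidef Q"
    and lmi: "transpose (A + mat (k\<^sup>2 / 2)) ** Q + Q ** (A + mat (k\<^sup>2 / 2))
           + (\<Sum>i\<in>UNIV. transpose (N i) ** Q ** N i) \<le>\<^sub>L - (Q ** B ** transpose B ** Q)"
    and u: "L2_control T u" "\<And>t. t \<in> {0..T} \<Longrightarrow> norm (u t) \<le> k"
    and x: "bilinear_solution A B N T 0 u x"
    and t: "t \<in> {0..T}"
  shows "x t \<bullet> (Q *v x t) \<le> (L2_control_norm T u)\<^sup>2"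
proof -
  define I where "I = (\<integral>t. (norm (u t))\<^sup>2 \<partial>lebesgue_on {0..T})"
  have norm_u: "(L2_control_norm T u)\<^sup>2 = I"
    unfolding L2_control_norm_def I_def by (intro real_sqrt_pow2 integral_nonneg_AE) auto
  have I: "((\<lambda>t. (norm (u t))\<^sup>2) has_integral I) {0..T}"
    unfolding I_def using u(1) by (intro has_integral_integral_lebesgue_on) (auto simp: L2_control_def)
  then have int_T: "(\<lambda>t. (norm (u t))\<^sup>2) integrable_on {0..T}" by blast
  then have int_t: "(\<lambda>t. (norm (u t))\<^sup>2) integrable_on {0..t}"
    by (rule integrable_subinterval_real) (use t in auto)
  define V where "V s = x s \<bullet> (Q *v x s)" for s
  define f where "f s = A *v x s + B *v u s + (\<Sum>i\<in>UNIV. (u s $ i) *\<^sub>R (N i *v x s))" for s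
  have x0: "x 0 = 0" and ac: "abs_continuous_on {0..T} x"
    and ode: "AE s in lebesgue_on {0..T}. (x has_vector_derivative f s) (at s within {0..T})"
    using x by (auto simp: bilinear_solution_def f_def)
  obtain E where E: "negligible E"
    "\<And>s. s \<in> {0..T} - E \<Longrightarrow> (x has_vector_derivative f s) (at s within {0..T})"
    using AE_lebesgue_on_negligible[OF ode] by auto
  have "V t - V 0 \<le> integral {0..t} (\<lambda>t. (norm (u t))\<^sup>2)"
  proof (rule abs_continuous_on_diff_le_integral[where g = V and h = "\<lambda>t. (norm (u t))\<^sup>2", OF _ _ E(1)])
    show "0 \<le> t" using t by simp
    have "abs_continuous_on {0..t} x" using t by (intro abs_continuous_on_subset[OF ac]) auto
    then show "abs_continuous_on {0..t} V"
      unfolding V_def by (rule abs_continuous_on_quadratic_form)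
    show "((\<lambda>t. (norm (u t))\<^sup>2) has_integral integral {0..t} (\<lambda>t. (norm (u t))\<^sup>2)) {0..t}"
      using int_t by blast
    fix s assume s: "s \<in> {0..t} - E"
    then have sT: "s \<in> {0..T} - E" using t by auto
    have dx: "(x has_vector_derivative f s) (at s within {0..t})"
      by (rule has_vector_derivative_within_subset[OF E(2)[OF sT]]) (use t in auto)
    have dQx: "((\<lambda>s. Q *v x s) has_vector_derivative (Q *v f s)) (at s within {0..t})"
      by (rule bounded_linear.has_vector_derivative[OF matrix_vector_mul_bounded_linear dx])
    have "(V has_vector_derivative (x s \<bullet> (Q *v f s) + f s \<bullet> (Q *v x s))) (at s within {0..t})"
      unfolding V_def
      by (rule bounded_bilinear.has_vector_derivative[OF bounded_bilinear_inner dx dQx])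
    moreover have "x s \<bullet> (Q *v f s) = f s \<bullet> (Q *v x s)"
      using Q inner_matrix_vector_mult_transpose[of "x s" Q] by (simp add: pos_semidef_def inner_commute)
    moreover have "2 * (f s \<bullet> (Q *v x s)) \<le> (norm (u s))\<^sup>2"
      unfolding f_def using sT by (intro Gramian_dissipation[OF Q _ lmi] u) auto
    ultimately show "\<exists>D\<le>(norm (u s))\<^sup>2. (V has_real_derivative D) (at s within {0..t})"
      by (auto simp: has_real_derivative_iff_has_vector_derivative)
  qed
  also have "\<dots> \<le> integral {0..T} (\<lambda>t. (norm (u t))\<^sup>2)"
    using t by (intro integral_subset_le int_T int_t) auto
  also have "\<dots> = I" using I by (rule integral_unique)
  finally show ?thesis using x0 norm_u by (simp add: V_def)
qed

theorem mainTheorem3: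
  fixes A :: "real^'n^'n" and N :: "'m::finite \<Rightarrow> real^'n^'n" and B :: "real^'m^'n"
    and P :: "real^'n^'n" and k T :: real
    and p :: "'n \<Rightarrow> real^'n" and lam :: "'n \<Rightarrow> real"
    and u :: "real \<Rightarrow> real^'m" and x :: "real \<Rightarrow> real^'n"
  assumes "k > 0" and "T > 0"
    and "spectrum (map_matrix complex_of_real
           (mat 1 \<otimes>\<^sub>K (A + mat (k\<^sup>2 / 2)) + (A + mat (k\<^sup>2 / 2)) \<otimes>\<^sub>K mat 1
              + (\<Sum>i\<in>UNIV. N i \<otimes>\<^sub>K N i)) :: complex^('n \<times> 'n)^('n \<times> 'n))
         \<subseteq> {z. Re z < 0}"
    and "pos_def P"
    and "transpose (A + mat (k\<^sup>2 / 2)) ** matrix_inv P + matrix_inv P ** (A + mat (k\<^sup>2 / 2))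
           + (\<Sum>i\<in>UNIV. transpose (N i) ** matrix_inv P ** N i)
         \<le>\<^sub>L - (matrix_inv P ** B ** transpose B ** matrix_inv P)"
    and "orthonormal_basis p"
    and "\<And>j. P *v p j = lam j *\<^sub>R p j"
    and "L2_control T u"
    and "\<And>t. t \<in> {0..T} \<Longrightarrow> norm (u t) \<le> k"
    and "bilinear_solution A B N T 0 u x"
  shows "\<forall>j. lam j powr (-1/2) * (SUP t\<in>{0..T}. \<bar>x t \<bullet> p j\<bar>) \<le> L2_control_norm T u"
proof
  fix j
  note P = \<open>pos_def P\<close>
  let ?u = "L2_control_norm T u"
  have "pos_def (matrix_inv P)" by (rule pos_def_matrix_inv[OF P])
  then have Q: "pos_semidef (matrix_inv P)"
    by (auto simp: pos_def_def pos_semidef_def) (metis inner_zero_left less_eq_real_def)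
  have "norm (p j) = 1" using \<open>orthonormal_basis p\<close> by (simp add: orthonormal_basis_def norm_eq_1)
  note eig = eigenvector_component_bound[OF P assms(7) this]
  have "?u \<ge> 0" by (simp add: L2_control_norm_def integral_nonneg_AE)
  have bound: "lam j powr (-1/2) * \<bar>x t \<bullet> p j\<bar> \<le> ?u" if t: "t \<in> {0..T}" for t
  proof -
    have "x t \<bullet> (matrix_inv P *v x t) \<le> ?u\<^sup>2"
      by (rule bilinear_solution_quadratic_form_le[OF Q assms(5) \<open>L2_control T u\<close> assms(9,10) t])
    then have "(x t \<bullet> p j)\<^sup>2 \<le> lam j * ?u\<^sup>2"
      by (intro order_trans[OF eig(2)] mult_left_mono) (use eig(1) in auto)
    from powr_neg_half_mult_le[OF eig(1) this] \<open>?u \<ge> 0\<close> show ?thesis by simp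
  qed
  have pos: "lam j powr (-1/2) > 0" using eig(1) by simp
  have "(SUP t\<in>{0..T}. \<bar>x t \<bullet> p j\<bar>) \<le> ?u / lam j powr (-1/2)"
    using \<open>T > 0\<close> bound pos by (intro cSUP_least) (auto simp: pos_le_divide_eq mult.commute)
  then show "lam j powr (-1/2) * (SUP t\<in>{0..T}. \<bar>x t \<bullet> p j\<bar>) \<le> ?u"
    using pos by (simp add: pos_le_divide_eq mult.commute)
qed

end
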